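(* Let $F$ be strictly convex, let $\Theta_j$ be strictly convex for every $j\in J$, and let $S$ be convex. Suppose that for any $x,y\in S$ with $x\neq y$, there exists $i\in I$ such that $L(x,y)\cap\Omega_i=\emptyset$ or there exists $j\in J$ such that $L(x,y)\cap\Theta_j=\emptyset$. Assume that for every $x\in S$ the projection sets satisfy $\mathcal{P}_F(x;\Omega_i)\neq\emptyset$ and $\Pi_F(x;\Theta_j)\neq\emptyset$ for all $i\in I$ and $j\in J$. Then the function $$\mathcal{H}(x)=\sum_{i\in I}C_F(x;\Omega_i)+\sum_{j\in J}T_F(x;\Theta_j)$$ is strictly convex on $S$, and the optimization problem: minimize $\mathcal{H}(x)$ subject to $x\in S$, cannot have more than one solution.
   Context: Standing setting: $X$ is a (real) normed space; $F\subset X$ is a closed, bounded, convex set containing $0$ as an interior point; $I$ and $J$ are finite index sets with $I\cup J\neq\emptyset$; $\Omega_i\subset X$ is nonempty, closed and bounded for every $i\in I$; $\Theta_j\subset X$ is nonempty and closed for every $j\in J$; $S\subset X$ is nonempty and closed. A set $C\subset X$ is strictly convex if for all $x,y\in C$ with $x\neq y$ and all $t\in(0,1)$ one has $tx+(1-t)y\in\operatorname{int}C$. A function $f$ is strictly convex on a convex set $S$ if $f(tx+(1-t)y)<tf(x)+(1-t)f(y)$ for all $x,y\in S$, $x\neq y$, $t\in(0,1)$. For $x\neq y$ in $X$, $L(x,y):=\{tx+(1-t)y: t\in\mathbb{R}\}$. $\rho_F(x):=\inf\{t\ge 0: x\in tF\}$. For a nonempty closed bounded set $Q\subset X$, $C_F(x;Q):=\inf\{t\ge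 0: Q\subset x+tF\}=\sup\{\rho_F(q-x): q\in Q\}$. For a nonempty closed set $Q\subset X$, $T_F(x;Q):=\inf\{t\ge 0: (x+tF)\cap Q\neq\emptyset\}=\inf\{\rho_F(q-x): q\in Q\}$. Farthest projection: $\mathcal{P}_F(x;\Omega):=\{\omega\in\Omega: \rho_F(\omega-x)=C_F(x;\Omega)\}$. Projection: $\Pi_F(x;\Theta):=\{u\in\Theta:\rho_F(u-x)=T_F(x;\Theta)\}$. *)

theory Defs
  imports "HOL-Analysis.Analysis"
begin

definition strictly_convex :: "'a::real_normed_vector set \<Rightarrow> bool" where
  "strictly_convex C \<longleftrightarrow>
     (\<forall>x\<in>C. \<forall>y\<in>C. \<forall>t\<in>{0<..<1::real}. x \<noteq> y \<longrightarrow> t *\<^sub>R x + (1 - t) *\<^sub>R y \<in> interior C)"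

definition strictly_convex_on :: "'a::real_vector set \<Rightarrow> ('a \<Rightarrow> real) \<Rightarrow> bool" where
  "strictly_convex_on S f \<longleftrightarrow> convex S \<and>
     (\<forall>x\<in>S. \<forall>y\<in>S. \<forall>t\<in>{0<..<1::real}. x \<noteq> y \<longrightarrow>
        f (t *\<^sub>R x + (1 - t) *\<^sub>R y) < t * f x + (1 - t) * f y)"

definition line_through :: "'a::real_vector \<Rightarrow> 'a \<Rightarrow> 'a set" where
  "line_through x y = {t *\<^sub>R x + (1 - t) *\<^sub>R y | t::real. True}"

text \<open>The infima below are taken in the reals. In the standing setting (\<open>F\<close> has \<open>0\<close> in its
  interior, and \<open>Q\<close> is nonempty, and bounded in the case of \<open>max_time\<close>) the sets involved are
  nonempty and bounded below by 0, so that \<open>Inf\<close> is the true infimum.\<close>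

definition minkowski_gauge :: "'a::real_normed_vector set \<Rightarrow> 'a \<Rightarrow> real" where
  "minkowski_gauge F x = Inf {t. 0 \<le> t \<and> x \<in> (*\<^sub>R) t ` F}"

definition max_time :: "'a::real_normed_vector set \<Rightarrow> 'a \<Rightarrow> 'a set \<Rightarrow> real" where
  "max_time F x Q = Inf {t. 0 \<le> t \<and> Q \<subseteq> (+) x ` ((*\<^sub>R) t ` F)}"

definition min_time :: "'a::real_normed_vector set \<Rightarrow> 'a \<Rightarrow> 'a set \<Rightarrow> real" where
  "min_time F x Q = Inf {t. 0 \<le> t \<and> (+) x ` ((*\<^sub>R) t ` F) \<inter> Q \<noteq> {}}"

definition farthest_proj :: "'a::real_normed_vector set \<Rightarrow> 'a \<Rightarrow> 'a set \<Rightarrow> 'a set" where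
  "farthest_proj F x \<Omega> = {\<omega>\<in>\<Omega>. minkowski_gauge F (\<omega> - x) = max_time F x \<Omega>}"

definition nearest_proj :: "'a::real_normed_vector set \<Rightarrow> 'a \<Rightarrow> 'a set \<Rightarrow> 'a set" where
  "nearest_proj F x \<Theta> = {u\<in>\<Theta>. minkowski_gauge F (u - x) = min_time F x \<Theta>}"

definition total_time ::
  "'a::real_normed_vector set \<Rightarrow> 'i set \<Rightarrow> ('i \<Rightarrow> 'a set) \<Rightarrow> 'j set \<Rightarrow> ('j \<Rightarrow> 'a set) \<Rightarrow> 'a \<Rightarrow> real" where
  "total_time F I \<Omega> J \<Theta> x = (\<Sum>i\<in>I. max_time F x (\<Omega> i)) + (\<Sum>j\<in>J. min_time F x (\<Theta> j))"

end

theory Submission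
  imports Defs
begin

text \<open>
  Every summand of the objective is convex on \<open>S\<close>, and it is strictly convex along the segment
  from \<open>x\<close> to \<open>y\<close> as soon as its target set misses the line through \<open>x\<close> and \<open>y\<close>; the
  hypothesis on lines therefore makes at least one summand strict for each pair, which is enough
  for the sum. Strict convexity excludes two minimizers, since their midpoint would be better.

  The source of strictness is the gauge of the strictly convex body \<open>F\<close>, which is itself far from
  strictly convex: it is linear on rays. However, its triangle inequality is strict for vectors
  in different directions, and \<open>w - x\<close> and \<open>w - y\<close> have different directions whenever \<open>w\<close> lies
  off the line through \<open>x\<close> and \<open>y\<close>. Hence the cost \<open>minkowski_gauge F (w - z)\<close> of reaching a
  point \<open>w\<close> off that line is strictly convex in \<open>z\<close> along it (\<open>gauge_to_point_strict\<close>).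

  For the maximal time this is applied to a point \<open>w\<close> of the target farthest from the intermediate
  point \<open>z\<close> (\<open>max_time_strict\<close>). For the minimal time let \<open>u\<close> and \<open>v\<close> be points of the target
  nearest to \<open>x\<close> and \<open>y\<close> (\<open>min_time_strict\<close>). If \<open>u = v\<close>, the same estimate applies. If
  \<open>u \<noteq> v\<close>, strictness comes from the target: the combination of \<open>u\<close> and \<open>v\<close> corresponding to
  \<open>z\<close> is interior to it, and it differs from \<open>z\<close>, which lies on the line and so outside the target;
  hence the target is reached strictly before that point.
\<close>

section \<open>The gauge of a closed bounded convex neighbourhood of the origin\<close>

locale gauge_body =
  fixes F :: "'a::real_normed_vector set"
  assumes closed_body: "closed F"
    and bounded_body: "bounded F"
    and convex_body: "convex F"
    and zero_interior: "0 \<in> interior F"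
begin

lemma zero_mem: "0 \<in> F"
  using zero_interior interior_subset by blast

lemma scaled_bodyI:
  assumes "f \<in> F" "x = t *\<^sub>R f"
  shows "x \<in> (*\<^sub>R) t ` F"
  using assms(2,1) by (rule image_eqI)

lemma scaled_body_mono:
  assumes "0 \<le> s" "s \<le> t"
  shows "(*\<^sub>R) s ` F \<subseteq> (*\<^sub>R) t ` F"
proof
  fix x assume "x \<in> (*\<^sub>R) s ` F"
  then obtain f where f: "f \<in> F" "x = s *\<^sub>R f" by blast
  show "x \<in> (*\<^sub>R) t ` F"
  proof (cases "t = 0")
    case True
    then show ?thesis using assms f by auto
  next
    case False
    have "(s / t) *\<^sub>R f + (1 - s / t) *\<^sub>R 0 \<in> F"
      using assms False f(1) zero_mem by (intro convexD[OF convex_body]) auto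
    then have "(s / t) *\<^sub>R f \<in> F" by simp
    moreover have "x = t *\<^sub>R ((s / t) *\<^sub>R f)" using False f by simp
    ultimately show ?thesis by (rule scaled_bodyI)
  qed
qed

lemma gauge_le:
  assumes "0 \<le> t" "x \<in> (*\<^sub>R) t ` F"
  shows "minkowski_gauge F x \<le> t"
  unfolding minkowski_gauge_def
  by (rule cInf_lower) (use assms in \<open>auto intro!: bdd_belowI[of _ 0]\<close>)

lemma absorbing: "\<exists>c>0. \<forall>x. x \<in> (*\<^sub>R) (c * norm x) ` F"
proof -
  obtain e where e: "0 < e" "cball 0 e \<subseteq> F"
    using zero_interior mem_interior_cball by blast
  have "x \<in> (*\<^sub>R) (1 / e * norm x) ` F" for x
  proof (cases "x = 0")
    case True
    then show ?thesis using zero_mem by force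
  next
    case False
    have "(e / norm x) *\<^sub>R x \<in> F"
      using e False by (intro subsetD[OF e(2)]) auto
    moreover have "x = (1 / e * norm x) *\<^sub>R ((e / norm x) *\<^sub>R x)" using e False by simp
    ultimately show ?thesis by (rule scaled_bodyI)
  qed
  then show ?thesis using e(1) by (intro exI[of _ "1 / e"]) auto
qed

lemma gauge_nonneg: "0 \<le> minkowski_gauge F x"
proof -
  obtain c where "0 < c" "x \<in> (*\<^sub>R) (c * norm x) ` F" using absorbing by blast
  then have "c * norm x \<in> {t. 0 \<le> t \<and> x \<in> (*\<^sub>R) t ` F}" by simp
  then have "{t. 0 \<le> t \<and> x \<in> (*\<^sub>R) t ` F} \<noteq> {}" by blast
  then show ?thesis unfolding minkowski_gauge_def by (intro cInf_greatest) auto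
qed

lemma gauge_linear_bound: "\<exists>c>0. \<forall>x. minkowski_gauge F x \<le> c * norm x"
proof -
  obtain c where c: "0 < c" "\<And>x. x \<in> (*\<^sub>R) (c * norm x) ` F" using absorbing by blast
  then have "minkowski_gauge F x \<le> c * norm x" for x by (intro gauge_le) auto
  then show ?thesis using c(1) by blast
qed

text \<open>The infimum defining the gauge is attained. For a positive value this follows from closedness,
  by a limit of dilation factors from above; for the value 0 it follows from boundedness, because
  only the origin lies in all small dilates of a bounded set.\<close>

lemma mem_gauge_body: "x \<in> (*\<^sub>R) (minkowski_gauge F x) ` F"
proof -
  define r where "r = minkowski_gauge F x"
  have r0: "0 \<le> r" unfolding r_def by (rule gauge_nonneg)
  have above: "x \<in> (*\<^sub>R) s ` F" if "r < s" for s
  proof -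
    obtain c where "0 < c" "x \<in> (*\<^sub>R) (c * norm x) ` F" using absorbing by blast
    then have "c * norm x \<in> {t. 0 \<le> t \<and> x \<in> (*\<^sub>R) t ` F}" by simp
    then have "{t. 0 \<le> t \<and> x \<in> (*\<^sub>R) t ` F} \<noteq> {}" by blast
    from cInf_lessD[OF this that[unfolded r_def minkowski_gauge_def]]
    obtain t where "0 \<le> t" "t < s" "x \<in> (*\<^sub>R) t ` F" by blast
    then show ?thesis using scaled_body_mono[of t s] by auto
  qed
  have "x \<in> (*\<^sub>R) r ` F"
  proof (cases "r = 0")
    case True
    obtain B where B: "0 < B" "\<And>f. f \<in> F \<Longrightarrow> norm f \<le> B"
      using bounded_body bounded_pos by blast
    have "norm x \<le> 0"
    proof (rule field_le_epsilon)
      fix e :: real assume "0 < e"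
      then have "x \<in> (*\<^sub>R) (e / B) ` F" using above B(1) True by simp
      then obtain f where "f \<in> F" "x = (e / B) *\<^sub>R f" by blast
      then show "norm x \<le> 0 + e"
        using B(2)[of f] B(1) \<open>0 < e\<close> by (simp add: field_simps)
    qed
    then show ?thesis using True zero_mem by force
  next
    case False
    with r0 have r: "0 < r" by simp
    have "(\<lambda>n. inverse (r + inverse (real (Suc n))) *\<^sub>R x) \<longlonglongrightarrow> inverse (r + 0) *\<^sub>R x"
      using r by (intro tendsto_intros LIMSEQ_inverse_real_of_nat) auto
    moreover have "inverse (r + inverse (real (Suc n))) *\<^sub>R x \<in> F" for n
    proof -
      have p: "0 < r + inverse (real (Suc n))" using r by (simp add: add_pos_pos)
      obtain f where "f \<in> F" "x = (r + inverse (real (Suc n))) *\<^sub>R f"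
        using above[of "r + inverse (real (Suc n))"] by auto
      then show ?thesis using p by simp
    qed
    ultimately have "inverse r *\<^sub>R x \<in> F"
      using closed_sequentially[OF closed_body, of "\<lambda>n. inverse (r + inverse (real (Suc n))) *\<^sub>R x"]
      by simp
    moreover have "x = r *\<^sub>R (inverse r *\<^sub>R x)" using r by simp
    ultimately show ?thesis by (rule scaled_bodyI)
  qed
  then show ?thesis unfolding r_def .
qed

lemma mem_scaled_body_iff:
  assumes "0 \<le> t"
  shows "x \<in> (*\<^sub>R) t ` F \<longleftrightarrow> minkowski_gauge F x \<le> t"
proof
  show "minkowski_gauge F x \<le> t" if "x \<in> (*\<^sub>R) t ` F" using assms that by (rule gauge_le)
  show "x \<in> (*\<^sub>R) t ` F" if "minkowski_gauge F x \<le> t"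
    using scaled_body_mono[OF gauge_nonneg that] mem_gauge_body by (rule subsetD)
qed

lemma gauge_pos:
  assumes "x \<noteq> 0"
  shows "0 < minkowski_gauge F x"
proof (rule ccontr)
  assume "\<not> 0 < minkowski_gauge F x"
  then have "minkowski_gauge F x = 0" using gauge_nonneg[of x] by simp
  with mem_gauge_body[of x] have "x \<in> (*\<^sub>R) 0 ` F" by (rule back_subst[where P = "\<lambda>t. x \<in> (*\<^sub>R) t ` F"])
  then obtain f where "x = 0 *\<^sub>R f" by (rule imageE)
  then show False using assms by simp
qed

lemma gauge_scale_le:
  assumes "0 \<le> c"
  shows "minkowski_gauge F (c *\<^sub>R x) \<le> c * minkowski_gauge F x"
proof (rule gauge_le)
  show "0 \<le> c * minkowski_gauge F x" using assms gauge_nonneg by simp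
  obtain f where "f \<in> F" "x = minkowski_gauge F x *\<^sub>R f" using mem_gauge_body[of x] by blast
  then show "c *\<^sub>R x \<in> (*\<^sub>R) (c * minkowski_gauge F x) ` F"
    by (metis image_eqI scaleR_scaleR)
qed

lemma gauge_triangle: "minkowski_gauge F (u + v) \<le> minkowski_gauge F u + minkowski_gauge F v"
proof -
  define a b where "a = minkowski_gauge F u" and "b = minkowski_gauge F v"
  have ab: "0 \<le> a" "0 \<le> b" unfolding a_def b_def by (rule gauge_nonneg)+
  obtain f g where fg: "f \<in> F" "g \<in> F" "u = a *\<^sub>R f" "v = b *\<^sub>R g"
    using mem_gauge_body[of u] mem_gauge_body[of v] unfolding a_def b_def by blast
  have "u + v \<in> (*\<^sub>R) (a + b) ` F"
  proof (cases "a + b = 0")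
    case True
    then show ?thesis using ab fg zero_mem by (auto simp: add_nonneg_eq_0_iff)
  next
    case False
    have "(a / (a + b)) *\<^sub>R f + (b / (a + b)) *\<^sub>R g \<in> F"
      using ab False fg by (intro convexD[OF convex_body]) (auto simp: add_divide_distrib[symmetric])
    moreover have "u + v = (a + b) *\<^sub>R ((a / (a + b)) *\<^sub>R f + (b / (a + b)) *\<^sub>R g)"
      using False fg by (simp add: scaleR_right_distrib)
    ultimately show ?thesis by (rule scaled_bodyI)
  qed
  then show ?thesis using gauge_le ab unfolding a_def b_def by simp
qed

lemma gauge_convex_comb:
  assumes "0 \<le> t" "t \<le> 1"
  shows "minkowski_gauge F (t *\<^sub>R u + (1 - t) *\<^sub>R v)
           \<le> t * minkowski_gauge F u + (1 - t) * minkowski_gauge F v"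
  using gauge_triangle[of "t *\<^sub>R u" "(1 - t) *\<^sub>R v"] gauge_scale_le[of t u] gauge_scale_le[of "1 - t" v]
    assms by linarith

text \<open>An interior point of the body can be pushed slightly away from the origin without leaving it.\<close>

lemma gauge_interior_less_1:
  assumes "z \<in> interior F"
  shows "minkowski_gauge F z < 1"
proof -
  obtain e where e: "0 < e" "cball z e \<subseteq> F"
    using assms mem_interior_cball by blast
  define d where "d = e / (norm z + 1)"
  have d: "0 < d" unfolding d_def using e by (simp add: add_nonneg_pos)
  have "d * norm z \<le> e"
    unfolding d_def using e by (simp add: pos_divide_le_eq add_nonneg_pos distrib_left)
  then have "z + d *\<^sub>R z \<in> cball z e"
    using d by (simp add: dist_norm)
  then have "z + d *\<^sub>R z \<in> F" using e by blast
  moreover have "z = (1 / (1 + d)) *\<^sub>R (z + d *\<^sub>R z)"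
  proof -
    have "z + d *\<^sub>R z = (1 + d) *\<^sub>R z" by (simp add: scaleR_left_distrib)
    then show ?thesis using d by simp
  qed
  ultimately have "z \<in> (*\<^sub>R) (1 / (1 + d)) ` F" by (rule scaled_bodyI)
  then have "minkowski_gauge F z \<le> 1 / (1 + d)" using d by (intro gauge_le) auto
  also have "\<dots> < 1" using d by simp
  finally show ?thesis .
qed

text \<open>The vector \<open>a *\<^sub>R f + b *\<^sub>R g\<close> is \<open>a + b\<close> times a weighted average of two different
  points of the body, and strict convexity makes that average an interior point. This is the
  strict triangle inequality for vectors \<open>a *\<^sub>R f\<close> and \<open>b *\<^sub>R g\<close> with \<open>f\<close> and \<open>g\<close> of gauge 1.\<close>

lemma gauge_positive_comb_strict:
  assumes "strictly_convex F" "f \<in> F" "g \<in> F" "f \<noteq> g" "0 < a" "0 < b"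
  shows "minkowski_gauge F (a *\<^sub>R f + b *\<^sub>R g) < a + b"
proof -
  define s where "s = a / (a + b)"
  have s: "s \<in> {0<..<1}" "1 - s = b / (a + b)"
    unfolding s_def using assms by (auto simp: field_simps)
  have "s *\<^sub>R f + (1 - s) *\<^sub>R g \<in> interior F"
    using assms s(1) unfolding strictly_convex_def by blast
  then have 1: "minkowski_gauge F (s *\<^sub>R f + (1 - s) *\<^sub>R g) < 1" by (rule gauge_interior_less_1)
  have "a *\<^sub>R f + b *\<^sub>R g = (a + b) *\<^sub>R (s *\<^sub>R f + (1 - s) *\<^sub>R g)"
    unfolding s(2) using assms by (simp add: scaleR_right_distrib s_def)
  then have "minkowski_gauge F (a *\<^sub>R f + b *\<^sub>R g)
      \<le> (a + b) * minkowski_gauge F (s *\<^sub>R f + (1 - s) *\<^sub>R g)"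
    using gauge_scale_le[of "a + b"] assms by simp
  also have "\<dots> < (a + b) * 1" using 1 assms by (intro mult_strict_left_mono) auto
  finally show ?thesis by simp
qed

text \<open>Normalize \<open>w - x\<close> and \<open>w - y\<close> to gauge 1. If the results differ, strict convexity of the body
  gives the strict inequality; if they agree, then \<open>w\<close> is an affine combination of \<open>x\<close> and \<open>y\<close>.\<close>

lemma gauge_to_point_strict:
  assumes "strictly_convex F" "x \<noteq> y" "w \<notin> line_through x y" "0 < t" "t < 1"
  shows "minkowski_gauge F (w - (t *\<^sub>R x + (1 - t) *\<^sub>R y))
           < t * minkowski_gauge F (w - x) + (1 - t) * minkowski_gauge F (w - y)"
proof -
  define a b where "a = minkowski_gauge F (w - x)" and "b = minkowski_gauge F (w - y)"
  have off: "w \<noteq> s *\<^sub>R x + (1 - s) *\<^sub>R y" for s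
    using assms(3) unfolding line_through_def by blast
  have "w \<noteq> x" "w \<noteq> y" using off[of 1] off[of 0] by auto
  then have ab: "0 < a" "0 < b" unfolding a_def b_def by (auto intro: gauge_pos)
  obtain f g where fg: "f \<in> F" "g \<in> F" "w - x = a *\<^sub>R f" "w - y = b *\<^sub>R g"
    using mem_gauge_body[of "w - x"] mem_gauge_body[of "w - y"] unfolding a_def b_def by blast
  have "f \<noteq> g"
  proof
    assume "f = g"
    with fg assms(2) have "a \<noteq> b" by (metis diff_left_imp_eq)
    have "b *\<^sub>R (w - x) = a *\<^sub>R (w - y)"
      using fg \<open>f = g\<close> by (simp add: mult.commute)
    then have *: "(b - a) *\<^sub>R w = b *\<^sub>R x + (- a) *\<^sub>R y"
      by (simp add: algebra_simps)
    have "w = (1 / (b - a)) *\<^sub>R ((b - a) *\<^sub>R w)" using \<open>a \<noteq> b\<close> by simp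
    also have "\<dots> = (b / (b - a)) *\<^sub>R x + (- a / (b - a)) *\<^sub>R y"
      unfolding * by (simp add: scaleR_right_diff_distrib)
    also have "- a / (b - a) = 1 - b / (b - a)"
      using \<open>a \<noteq> b\<close> by (simp add: field_simps)
    finally show False using off by blast
  qed
  have "w - (t *\<^sub>R x + (1 - t) *\<^sub>R y) = t *\<^sub>R (w - x) + (1 - t) *\<^sub>R (w - y)"
    by (simp add: algebra_simps)
  also have "\<dots> = (t * a) *\<^sub>R f + ((1 - t) * b) *\<^sub>R g" using fg by simp
  finally show ?thesis
    using gauge_positive_comb_strict[OF assms(1) fg(1,2) \<open>f \<noteq> g\<close>, of "t * a" "(1 - t) * b"] ab assms
    by (simp add: a_def b_def)
qed

section \<open>Maximal and minimal times as extrema of the gauge\<close>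

lemma mem_translated_body_iff:
  assumes "0 \<le> t"
  shows "q \<in> (+) x ` ((*\<^sub>R) t ` F) \<longleftrightarrow> minkowski_gauge F (q - x) \<le> t"
proof -
  have "q \<in> (+) x ` ((*\<^sub>R) t ` F) \<longleftrightarrow> q - x \<in> (*\<^sub>R) t ` F"
    using image_eqI[of q "(+) x" "q - x" "(*\<^sub>R) t ` F"] by auto
  then show ?thesis using mem_scaled_body_iff[OF assms] by simp
qed

lemma gauge_le_max_time:
  assumes "bounded Q" "q \<in> Q"
  shows "minkowski_gauge F (q - x) \<le> max_time F x Q"
  unfolding max_time_def
proof (rule cInf_greatest)
  obtain B where B: "\<And>p. p \<in> Q \<Longrightarrow> dist x p \<le> B"
    using assms(1) bounded_any_center[of Q x] by blast
  have "0 \<le> B" using B[OF assms(2)] zero_le_dist order_trans by blast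
  obtain c where c: "0 < c" "\<And>v. minkowski_gauge F v \<le> c * norm v"
    using gauge_linear_bound by blast
  have "minkowski_gauge F (p - x) \<le> c * B" if "p \<in> Q" for p
  proof -
    have "minkowski_gauge F (p - x) \<le> c * norm (p - x)" by (rule c)
    also have "\<dots> \<le> c * B"
      using B[OF that] c(1) by (intro mult_left_mono) (auto simp: dist_norm norm_minus_commute)
    finally show ?thesis .
  qed
  then have "c * B \<in> {t. 0 \<le> t \<and> Q \<subseteq> (+) x ` ((*\<^sub>R) t ` F)}"
    using c(1) \<open>0 \<le> B\<close> mem_translated_body_iff[of "c * B" _ x] by auto
  then show "{t. 0 \<le> t \<and> Q \<subseteq> (+) x ` ((*\<^sub>R) t ` F)} \<noteq> {}" by blast
next
  fix t assume "t \<in> {t. 0 \<le> t \<and> Q \<subseteq> (+) x ` ((*\<^sub>R) t ` F)}"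
  then show "minkowski_gauge F (q - x) \<le> t"
    using assms(2) mem_translated_body_iff[of t q x] by blast
qed

lemma min_time_le_gauge:
  assumes "q \<in> Q"
  shows "min_time F x Q \<le> minkowski_gauge F (q - x)"
  unfolding min_time_def
proof (rule cInf_lower)
  have "q \<in> (+) x ` ((*\<^sub>R) (minkowski_gauge F (q - x)) ` F)"
    by (simp only: mem_translated_body_iff[OF gauge_nonneg])
  then show "minkowski_gauge F (q - x) \<in> {t. 0 \<le> t \<and> (+) x ` ((*\<^sub>R) t ` F) \<inter> Q \<noteq> {}}"
    using assms gauge_nonneg[of "q - x"] by (simp only: mem_Collect_eq) (metis IntI empty_iff)
qed (auto intro!: bdd_belowI[of _ 0])

text \<open>Move from \<open>w\<close> towards \<open>z\<close> by a small step: the point reached is still in the target, and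
  its gauge from \<open>z\<close> has shrunk.\<close>

lemma min_time_less_gauge_interior:
  assumes "w \<in> interior Q" "w \<noteq> z"
  shows "min_time F z Q < minkowski_gauge F (w - z)"
proof -
  obtain e where e: "0 < e" "cball w e \<subseteq> Q"
    using assms mem_interior_cball by blast
  define d where "d = min 1 (e / norm (w - z))"
  have nz: "0 < norm (w - z)" using assms by simp
  have d: "0 < d" "d \<le> 1" unfolding d_def using e nz by auto
  have "d * norm (w - z) \<le> (e / norm (w - z)) * norm (w - z)"
    unfolding d_def by (intro mult_right_mono) auto
  then have "d * norm (w - z) \<le> e" using nz by simp
  then have "w - d *\<^sub>R (w - z) \<in> cball w e" using d by (simp add: dist_norm)
  then have "w - d *\<^sub>R (w - z) \<in> Q" using e by blast
  then have "min_time F z Q \<le> minkowski_gauge F (w - d *\<^sub>R (w - z) - z)" by (rule min_time_le_gauge)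
  also have "w - d *\<^sub>R (w - z) - z = (1 - d) *\<^sub>R (w - z)" by (simp add: algebra_simps)
  also have "minkowski_gauge F \<dots> \<le> (1 - d) * minkowski_gauge F (w - z)"
    using d by (intro gauge_scale_le) auto
  also have "\<dots> < 1 * minkowski_gauge F (w - z)"
    using d gauge_pos[of "w - z"] assms by (intro mult_strict_right_mono) auto
  finally show ?thesis by simp
qed

section \<open>Convexity and strict convexity of each summand\<close>

text \<open>A point farthest from the intermediate position bounds the maximal times at both ends from
  below, so convexity passes from the gauge to the maximum.\<close>

lemma max_time_convex:
  assumes "bounded Q" "0 < t" "t < 1"
    and "farthest_proj F (t *\<^sub>R x + (1 - t) *\<^sub>R y) Q \<noteq> {}"
  shows "max_time F (t *\<^sub>R x + (1 - t) *\<^sub>R y) Q \<le> t * max_time F x Q + (1 - t) * max_time F y Q"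
proof -
  obtain w where w: "w \<in> Q"
      "max_time F (t *\<^sub>R x + (1 - t) *\<^sub>R y) Q = minkowski_gauge F (w - (t *\<^sub>R x + (1 - t) *\<^sub>R y))"
    using assms(4) unfolding farthest_proj_def by fastforce
  have "w - (t *\<^sub>R x + (1 - t) *\<^sub>R y) = t *\<^sub>R (w - x) + (1 - t) *\<^sub>R (w - y)"
    by (simp add: algebra_simps)
  then have "max_time F (t *\<^sub>R x + (1 - t) *\<^sub>R y) Q
      \<le> t * minkowski_gauge F (w - x) + (1 - t) * minkowski_gauge F (w - y)"
    using w(2) gauge_convex_comb[of t "w - x" "w - y"] assms by simp
  also have "\<dots> \<le> t * max_time F x Q + (1 - t) * max_time F y Q"
    using gauge_le_max_time[OF assms(1) w(1)] assms by (intro add_mono mult_left_mono) auto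
  finally show ?thesis .
qed

lemma max_time_strict:
  assumes "strictly_convex F" "bounded Q" "x \<noteq> y" "0 < t" "t < 1"
    and "farthest_proj F (t *\<^sub>R x + (1 - t) *\<^sub>R y) Q \<noteq> {}" "line_through x y \<inter> Q = {}"
  shows "max_time F (t *\<^sub>R x + (1 - t) *\<^sub>R y) Q < t * max_time F x Q + (1 - t) * max_time F y Q"
proof -
  obtain w where w: "w \<in> Q"
      "max_time F (t *\<^sub>R x + (1 - t) *\<^sub>R y) Q = minkowski_gauge F (w - (t *\<^sub>R x + (1 - t) *\<^sub>R y))"
    using assms(6) unfolding farthest_proj_def by fastforce
  have "w \<notin> line_through x y" using w(1) assms(7) by blast
  then have "max_time F (t *\<^sub>R x + (1 - t) *\<^sub>R y) Q
      < t * minkowski_gauge F (w - x) + (1 - t) * minkowski_gauge F (w - y)"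
    using w(2) gauge_to_point_strict assms by simp
  also have "\<dots> \<le> t * max_time F x Q + (1 - t) * max_time F y Q"
    using gauge_le_max_time[OF assms(2) w(1)] assms by (intro add_mono mult_left_mono) auto
  finally show ?thesis .
qed

text \<open>Here the comparison runs the other way: points nearest to the two ends are combined, and
  convexity of the target makes the combination an admissible competitor for the minimum.\<close>

lemma min_time_convex:
  assumes "convex Q" "0 < t" "t < 1" "nearest_proj F x Q \<noteq> {}" "nearest_proj F y Q \<noteq> {}"
  shows "min_time F (t *\<^sub>R x + (1 - t) *\<^sub>R y) Q \<le> t * min_time F x Q + (1 - t) * min_time F y Q"
proof -
  obtain u v where uv: "u \<in> Q" "v \<in> Q"
      "minkowski_gauge F (u - x) = min_time F x Q" "minkowski_gauge F (v - y) = min_time F y Q"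
    using assms(4,5) unfolding nearest_proj_def by blast
  have "t *\<^sub>R u + (1 - t) *\<^sub>R v \<in> Q"
    using assms uv by (intro convexD) auto
  then have "min_time F (t *\<^sub>R x + (1 - t) *\<^sub>R y) Q
      \<le> minkowski_gauge F (t *\<^sub>R u + (1 - t) *\<^sub>R v - (t *\<^sub>R x + (1 - t) *\<^sub>R y))"
    by (rule min_time_le_gauge)
  also have "t *\<^sub>R u + (1 - t) *\<^sub>R v - (t *\<^sub>R x + (1 - t) *\<^sub>R y)
      = t *\<^sub>R (u - x) + (1 - t) *\<^sub>R (v - y)"
    by (simp add: algebra_simps)
  also have "minkowski_gauge F \<dots> \<le> t * min_time F x Q + (1 - t) * min_time F y Q"
    using gauge_convex_comb[of t "u - x" "v - y"] assms uv by simp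
  finally show ?thesis .
qed

text \<open>The body and the target supply strictness in complementary cases: equal nearest points use
  strict convexity of \<open>F\<close>, different ones use that of \<open>Q\<close>.\<close>

lemma min_time_strict:
  assumes "strictly_convex F" "strictly_convex Q" "x \<noteq> y" "0 < t" "t < 1"
    and "nearest_proj F x Q \<noteq> {}" "nearest_proj F y Q \<noteq> {}" "line_through x y \<inter> Q = {}"
  shows "min_time F (t *\<^sub>R x + (1 - t) *\<^sub>R y) Q < t * min_time F x Q + (1 - t) * min_time F y Q"
proof -
  define z where "z = t *\<^sub>R x + (1 - t) *\<^sub>R y"
  obtain u v where uv: "u \<in> Q" "v \<in> Q"
      "minkowski_gauge F (u - x) = min_time F x Q" "minkowski_gauge F (v - y) = min_time F y Q"
    using assms(6,7) unfolding nearest_proj_def by blast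
  have "min_time F z Q < t * minkowski_gauge F (u - x) + (1 - t) * minkowski_gauge F (v - y)"
  proof (cases "u = v")
    case True
    have "u \<notin> line_through x y" using uv assms(8) by blast
    then show ?thesis
      using min_time_le_gauge[OF uv(1), of z] gauge_to_point_strict[of x y u t] assms True
      unfolding z_def by simp
  next
    case False
    define w where "w = t *\<^sub>R u + (1 - t) *\<^sub>R v"
    have w: "w \<in> interior Q"
      unfolding w_def using False uv assms unfolding strictly_convex_def by simp
    have "z \<in> line_through x y" unfolding z_def line_through_def by blast
    then have "w \<noteq> z" using w assms(8) interior_subset by blast
    with w have "min_time F z Q < minkowski_gauge F (w - z)" by (rule min_time_less_gauge_interior)
    also have "w - z = t *\<^sub>R (u - x) + (1 - t) *\<^sub>R (v - y)"
      unfolding w_def z_def by (simp add: algebra_simps)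
    also have "minkowski_gauge F \<dots>
        \<le> t * minkowski_gauge F (u - x) + (1 - t) * minkowski_gauge F (v - y)"
      using assms by (intro gauge_convex_comb) auto
    finally show ?thesis .
  qed
  then show ?thesis unfolding z_def uv .
qed

end

section \<open>Strict convexity of the total time and uniqueness of its minimizer\<close>

lemma strictly_convex_imp_convex:
  fixes C :: "'a::real_normed_vector set"
  assumes "strictly_convex C"
  shows "convex C"
  unfolding convex_alt
proof (intro ballI allI impI)
  fix x y and u :: real
  assume xy: "x \<in> C" "y \<in> C" and u: "0 \<le> u \<and> u \<le> 1"
  show "(1 - u) *\<^sub>R x + u *\<^sub>R y \<in> C"
  proof (cases "x = y \<or> u = 0 \<or> u = 1")
    case True
    then show ?thesis using xy by (auto simp: scaleR_left_distrib[symmetric])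
  next
    case False
    then have "1 - u \<in> {0<..<1}" using u by auto
    then have "(1 - u) *\<^sub>R x + (1 - (1 - u)) *\<^sub>R y \<in> interior C"
      using assms xy False unfolding strictly_convex_def by blast
    then show ?thesis using interior_subset by auto
  qed
qed

lemma strictly_convex_on_at_most_one_minimizer:
  assumes "strictly_convex_on S f"
  shows "\<exists>\<^sub>\<le>\<^sub>1x. is_arg_min f (\<lambda>x. x \<in> S) x"
proof (rule Uniq_I, rule ccontr)
  fix x y
  assume x: "is_arg_min f (\<lambda>x. x \<in> S) x" and y: "is_arg_min f (\<lambda>x. x \<in> S) y" and ne: "x \<noteq> y"
  have xy: "x \<in> S" "y \<in> S" using x y unfolding is_arg_min_def by auto
  then have eq: "f x = f y" using x y unfolding is_arg_min_def by fastforce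
  define m where "m = (1 / 2) *\<^sub>R x + (1 - 1 / 2) *\<^sub>R y"
  have "m \<in> S"
    using assms xy unfolding strictly_convex_on_def m_def by (intro convexD) auto
  moreover have "f m < 1 / 2 * f x + (1 - 1 / 2) * f y"
    unfolding m_def by (rule assms[unfolded strictly_convex_on_def, THEN conjunct2, rule_format])
      (use xy ne in auto)
  ultimately show False using x eq unfolding is_arg_min_def by simp
qed

lemma sum_add_less_if_some_less:
  fixes a a' :: "'i \<Rightarrow> real" and b b' :: "'j \<Rightarrow> real"
  assumes "finite I" "finite J"
    and "\<And>i. i \<in> I \<Longrightarrow> a i \<le> a' i" "\<And>j. j \<in> J \<Longrightarrow> b j \<le> b' j"
    and "(\<exists>i\<in>I. a i < a' i) \<or> (\<exists>j\<in>J. b j < b' j)"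
  shows "sum a I + sum b J < sum a' I + sum b' J"
  using assms(5)
proof
  assume "\<exists>i\<in>I. a i < a' i"
  then show ?thesis
    using assms by (intro add_less_le_mono sum_strict_mono_ex1 sum_mono) auto
next
  assume "\<exists>j\<in>J. b j < b' j"
  then show ?thesis
    using assms by (intro add_le_less_mono sum_strict_mono_ex1 sum_mono) auto
qed

theorem theorem3p13:
  fixes F S :: "'a::real_normed_vector set"
    and I :: "'i set" and \<Omega> :: "'i \<Rightarrow> 'a set"
    and J :: "'j set" and \<Theta> :: "'j \<Rightarrow> 'a set"
  assumes "closed F" "bounded F" "convex F" "0 \<in> interior F"
    and "finite I" "finite J" "I \<noteq> {} \<or> J \<noteq> {}"
    and "\<And>i. i \<in> I \<Longrightarrow> \<Omega> i \<noteq> {} \<and> closed (\<Omega> i) \<and> bounded (\<Omega> i)"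
    and "\<And>j. j \<in> J \<Longrightarrow> \<Theta> j \<noteq> {} \<and> closed (\<Theta> j)"
    and "S \<noteq> {}" "closed S"
    and "strictly_convex F"
    and "\<And>j. j \<in> J \<Longrightarrow> strictly_convex (\<Theta> j)"
    and "convex S"
    and "\<And>x y. x \<in> S \<Longrightarrow> y \<in> S \<Longrightarrow> x \<noteq> y \<Longrightarrow>
           (\<exists>i\<in>I. line_through x y \<inter> \<Omega> i = {}) \<or> (\<exists>j\<in>J. line_through x y \<inter> \<Theta> j = {})"
    and "\<And>x i. x \<in> S \<Longrightarrow> i \<in> I \<Longrightarrow> farthest_proj F x (\<Omega> i) \<noteq> {}"
    and "\<And>x j. x \<in> S \<Longrightarrow> j \<in> J \<Longrightarrow> nearest_proj F x (\<Theta> j) \<noteq> {}"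
  shows "strictly_convex_on S (total_time F I \<Omega> J \<Theta>) \<and>
         (\<exists>\<^sub>\<le>\<^sub>1x. is_arg_min (total_time F I \<Omega> J \<Theta>) (\<lambda>x. x \<in> S) x)"
proof -
  interpret gauge_body F using assms(1-4) by unfold_locales
  note fin = assms(5,6) and bdd_\<Omega> = assms(8) and sc_F = assms(12) and sc_\<Theta> = assms(13)
    and conv_S = assms(14) and misses = assms(15) and far = assms(16) and near = assms(17)
  have "strictly_convex_on S (total_time F I \<Omega> J \<Theta>)"
    unfolding strictly_convex_on_def
  proof (intro conjI ballI impI conv_S)
    fix x y and t :: real
    assume xy: "x \<in> S" "y \<in> S" "x \<noteq> y" and "t \<in> {0<..<1}"
    then have t: "0 < t" "t < 1" by auto
    define z where "z = t *\<^sub>R x + (1 - t) *\<^sub>R y"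
    have z: "z \<in> S" unfolding z_def using conv_S xy t by (intro convexD) auto
    have "total_time F I \<Omega> J \<Theta> z
        < (\<Sum>i\<in>I. t * max_time F x (\<Omega> i) + (1 - t) * max_time F y (\<Omega> i))
        + (\<Sum>j\<in>J. t * min_time F x (\<Theta> j) + (1 - t) * min_time F y (\<Theta> j))"
      unfolding total_time_def
    proof (rule sum_add_less_if_some_less[OF fin])
      fix i assume "i \<in> I"
      then show "max_time F z (\<Omega> i) \<le> t * max_time F x (\<Omega> i) + (1 - t) * max_time F y (\<Omega> i)"
        using max_time_convex[of "\<Omega> i" t x y] bdd_\<Omega> t far[OF z] unfolding z_def by blast
    next
      fix j assume "j \<in> J"
      then show "min_time F z (\<Theta> j) \<le> t * min_time F x (\<Theta> j) + (1 - t) * min_time F y (\<Theta> j)"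
        using min_time_convex[of "\<Theta> j" t x y] strictly_convex_imp_convex sc_\<Theta> t near xy
        unfolding z_def by blast
    next
      show "(\<exists>i\<in>I. max_time F z (\<Omega> i) < t * max_time F x (\<Omega> i) + (1 - t) * max_time F y (\<Omega> i))
          \<or> (\<exists>j\<in>J. min_time F z (\<Theta> j) < t * min_time F x (\<Theta> j) + (1 - t) * min_time F y (\<Theta> j))"
        using misses[OF xy]
      proof
        assume "\<exists>i\<in>I. line_through x y \<inter> \<Omega> i = {}"
        then obtain i where i: "i \<in> I" "line_through x y \<inter> \<Omega> i = {}" by blast
        then show ?thesis
          using max_time_strict[of "\<Omega> i" x y t] sc_F bdd_\<Omega> xy t far[OF z] unfolding z_def by blast
      next
        assume "\<exists>j\<in>J. line_through x y \<inter> \<Theta> j = {}"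
        then obtain j where j: "j \<in> J" "line_through x y \<inter> \<Theta> j = {}" by blast
        then show ?thesis
          using min_time_strict[of "\<Theta> j" x y t] sc_F sc_\<Theta> xy t near unfolding z_def by blast
      qed
    qed
    also have "\<dots> = t * total_time F I \<Omega> J \<Theta> x + (1 - t) * total_time F I \<Omega> J \<Theta> y"
      unfolding total_time_def by (simp add: sum.distrib sum_distrib_left distrib_left)
    finally show "total_time F I \<Omega> J \<Theta> (t *\<^sub>R x + (1 - t) *\<^sub>R y)
        < t * total_time F I \<Omega> J \<Theta> x + (1 - t) * total_time F I \<Omega> J \<Theta> y"
      unfolding z_def .
  qed
  then show ?thesis using strictly_convex_on_at_most_one_minimizer by blast
qed

end
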